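(* Suppose that $A_0$ and $A_1$ are jointly negative definite, that is, there exists $\mu_1\in\mathbb{R}$ such that $A_0+\mu_1A_1\prec 0$. Then the problem (GTRE) has at most one local-nonglobal minimizer.
   Context: Let $A_0,A_1$ be real symmetric $n\times n$ matrices, $b_0,b_1\in\mathbb{R}^n$, $c_1\in\mathbb{R}$, $f_0(x)=x^TA_0x+2b_0^Tx$, $f_1(x)=x^TA_1x+2b_1^Tx+c_1$. Problem (GTRE) is: minimize $f_0(x)$ over $x\in\mathbb{R}^n$ subject to $f_1(x)=0$. A local-nonglobal minimizer is a feasible point that is a local minimizer but not a global minimizer (a global minimizer being a feasible point whose objective value is at most that of every feasible point). *)

theory Defs
  imports "HOL-Analysis.Analysis"
begin

definition symmetric_matrix :: "real ^ 'n ^ 'n \<Rightarrow> bool" where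
  "symmetric_matrix A \<longleftrightarrow> transpose A = A"

definition negative_definite :: "real ^ 'n ^ 'n \<Rightarrow> bool" where
  "negative_definite A \<longleftrightarrow> symmetric_matrix A \<and> (\<forall>x. x \<noteq> 0 \<longrightarrow> x \<bullet> (A *v x) < 0)"

definition jointly_negative_definite :: "real ^ 'n ^ 'n \<Rightarrow> real ^ 'n ^ 'n \<Rightarrow> bool" where
  "jointly_negative_definite A B \<longleftrightarrow> (\<exists>\<mu>::real. negative_definite (A + \<mu> *\<^sub>R B))"

text \<open>The linear coefficient is \<open>2 b\<close>, so that the gradient is \<open>2 (A x + b)\<close> for symmetric \<open>A\<close>.\<close>

definition quadratic_fun :: "real ^ 'n ^ 'n \<Rightarrow> real ^ 'n \<Rightarrow> real \<Rightarrow> real ^ 'n \<Rightarrow> real" where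
  "quadratic_fun A b c x = x \<bullet> (A *v x) + 2 * (b \<bullet> x) + c"

definition global_minimizer_on :: "('a \<Rightarrow> real) \<Rightarrow> 'a set \<Rightarrow> 'a \<Rightarrow> bool" where
  "global_minimizer_on f S x \<longleftrightarrow> x \<in> S \<and> (\<forall>y\<in>S. f x \<le> f y)"

definition local_minimizer_on :: "('a::metric_space \<Rightarrow> real) \<Rightarrow> 'a set \<Rightarrow> 'a \<Rightarrow> bool" where
  "local_minimizer_on f S x \<longleftrightarrow> x \<in> S \<and> (\<exists>\<epsilon>>0. \<forall>y \<in> S \<inter> ball x \<epsilon>. f x \<le> f y)"

text \<open>If \<open>f\<close> does not attain its infimum on \<open>S\<close>, every local minimizer is local-nonglobal.\<close>

definition local_nonglobal_minimizer_on :: "('a::metric_space \<Rightarrow> real) \<Rightarrow> 'a set \<Rightarrow> 'a \<Rightarrow> bool" where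
  "local_nonglobal_minimizer_on f S x \<longleftrightarrow>
     local_minimizer_on f S x \<and> \<not> global_minimizer_on f S x"

definition gtre_objective :: "real ^ 'n ^ 'n \<Rightarrow> real ^ 'n \<Rightarrow> real ^ 'n \<Rightarrow> real" where
  "gtre_objective A\<^sub>0 b\<^sub>0 = quadratic_fun A\<^sub>0 b\<^sub>0 0"

definition gtre_feasible :: "real ^ 'n ^ 'n \<Rightarrow> real ^ 'n \<Rightarrow> real \<Rightarrow> (real ^ 'n) set" where
  "gtre_feasible A\<^sub>1 b\<^sub>1 c\<^sub>1 = {x. quadratic_fun A\<^sub>1 b\<^sub>1 c\<^sub>1 x = 0}"

end

theory Submission
  imports Defs
begin

text \<open>
  Adding a multiple of the constraint to the objective does not change the objective on the
  feasible set, so the objective may be taken to have a negative definite Hessian \<open>B\<close>.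
  Write \<open>A\<close> for the matrix of the constraint, and \<open>p x = B x + b\<close>, \<open>g x = A x + a\<close> for the
  half gradients of objective and constraint.

  The objective is strictly concave on every line, so a local minimizer
  cannot lie inside a line contained in the quadric: a nonzero tangent vector \<open>v\<close> satisfies
  \<open>v \<bullet> A v \<noteq> 0\<close> (\<open>tangent_not_isotropic\<close>).  At a singular point of the quadric every vector is
  tangent, so \<open>A\<close> has no nonzero isotropic vector, the quadric is a single point, and the minimizer is global.
  At a regular point, for small \<open>\<epsilon> \<noteq> 0\<close>, the line through \<open>x\<close> in the direction \<open>v + \<epsilon> g x\<close> meets the
  quadric in exactly one further point, which depends rationally on \<open>\<epsilon>\<close> and tends to \<open>x\<close>.
  Comparing objective values along this curve gives a Lagrange multiplier \<open>\<alpha>\<close>, and shows that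
  \<open>M\<^sub>\<alpha> = B + \<alpha> A\<close> is positive semidefinite on the tangent space.  The
  Lagrangian is quadratic, so positive semidefiniteness on the whole space would make \<open>x\<close> global.
  Hence \<open>M\<^sub>\<alpha>\<close> takes a negative value (\<open>saddle_multiplier\<close>).

  Let \<open>x \<noteq> y\<close> have multipliers \<open>\<alpha>\<close> and \<open>\<beta>\<close>, and let \<open>d = y - x\<close>.  Subtracting the
  stationarity equations gives \<open>M\<^sub>\<alpha> d = (\<alpha> - \<beta>) g y\<close> and \<open>M\<^sub>\<beta> d = (\<alpha> - \<beta>) g x\<close>: the vector \<open>d\<close> is
  conjugate to the tangent space of the \<^emph>\<open>other\<close> point.  The gap
  \<open>\<delta> = d \<bullet> M\<^sub>\<alpha> d = - d \<bullet> M\<^sub>\<beta> d\<close> is the difference of the objective values.  If \<open>\<alpha> = \<beta>\<close>, then \<open>d\<close> is a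
  null vector of \<open>M\<^sub>\<alpha>\<close>; since \<open>d \<bullet> B d < 0\<close>, it satisfies \<open>d \<bullet> A d \<noteq> 0\<close>, so that, both its end points
  being feasible, it is transversal to the tangent space, and \<open>M\<^sub>\<alpha>\<close> would be positive semidefinite.
  If \<open>\<alpha> \<noteq> \<beta>\<close>, then \<open>(\<alpha> - \<beta>) (d \<bullet> B d) = - (\<alpha> + \<beta>) \<delta>\<close>.  So \<open>\<delta> \<noteq> 0\<close>; interchanging the points makes
  \<open>\<delta> < 0\<close>, and then \<open>\<bar>\<alpha>\<bar> < \<bar>\<beta>\<bar>\<close>.  As \<open>M\<^sub>\<beta>\<close> is positive at \<open>d\<close>, its negative direction \<open>v\<close> can be
  chosen tangent at \<open>x\<close>, where \<open>M\<^sub>\<alpha>\<close> is nonnegative; this forces \<open>\<alpha>\<close> and \<open>\<beta>\<close> to have opposite signs.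
  But then \<open>M\<^sub>\<alpha>\<close> is negative on the tangent space of \<open>y\<close>, and
  also at the conjugate vector \<open>d\<close>, so it is negative definite, contrary to \<open>v \<bullet> M\<^sub>\<alpha> v \<ge> 0\<close>.
\<close>

section \<open>Quadratic functions\<close>

lemma symmetric_matrix_inner_commute:
  assumes "symmetric_matrix A"
  shows "x \<bullet> (A *v y) = y \<bullet> (A *v x)"
  using assms unfolding symmetric_matrix_def
  by (metis dot_lmul_matrix inner_commute transpose_matrix_vector)

lemma quadratic_fun_add:
  assumes "symmetric_matrix A"
  shows "quadratic_fun A a c (x + h) =
    quadratic_fun A a c x + 2 * ((A *v x + a) \<bullet> h) + h \<bullet> (A *v h)"
  using symmetric_matrix_inner_commute[OF assms, of x h]
  by (simp add: quadratic_fun_def inner_add_left inner_add_right matrix_vector_right_distrib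
      inner_commute algebra_simps)

lemma quadratic_form_scaleR:
  fixes A :: "real ^ 'n ^ 'n"
  shows "(t *\<^sub>R h) \<bullet> (A *v (t *\<^sub>R h)) = t\<^sup>2 * (h \<bullet> (A *v h))"
  by (simp add: matrix_vector_mult_scaleR power2_eq_square)

lemma quadratic_form_linear_combination:
  fixes A B :: "real ^ 'n ^ 'n"
  shows "v \<bullet> ((B + \<alpha> *\<^sub>R A) *v w) = v \<bullet> (B *v w) + \<alpha> * (v \<bullet> (A *v w))"
  by (simp add: matrix_vector_mult_add_rdistrib inner_add_right scaleR_matrix_vector_assoc[symmetric])

lemma symmetric_matrix_linear_combination:
  assumes "symmetric_matrix A" "symmetric_matrix B"
  shows "symmetric_matrix (B + \<alpha> *\<^sub>R A)"
  using assms by (simp add: symmetric_matrix_def transpose_def vec_eq_iff)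

lemma quadratic_fun_linear_combination:
  "quadratic_fun (B + \<alpha> *\<^sub>R A) (b + \<alpha> *\<^sub>R a) (k + \<alpha> * c) x =
    quadratic_fun B b k x + \<alpha> * quadratic_fun A a c x"
  by (simp add: quadratic_fun_def quadratic_form_linear_combination inner_add_left
      scaleR_matrix_vector_assoc[symmetric] algebra_simps)

lemma local_nonglobal_minimizer_on_cong:
  assumes "\<And>x. x \<in> S \<Longrightarrow> f x = h x"
  shows "local_nonglobal_minimizer_on f S x \<longleftrightarrow> local_nonglobal_minimizer_on h S x"
  using assms
  unfolding local_nonglobal_minimizer_on_def local_minimizer_on_def global_minimizer_on_def
  by (metis (no_types, lifting) IntD1)

section \<open>Optimality conditions for a strictly concave objective\<close>

text \<open>If \<open>v\<close> were isotropic, the whole line \<open>x + t v\<close> would be feasible, and a strictly concave function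
  on a line has no local minimum.\<close>

lemma tangent_not_isotropic:
  assumes A: "symmetric_matrix A" and B: "negative_definite B"
    and loc: "local_minimizer_on (quadratic_fun B b k) (gtre_feasible A a c) x"
    and v: "v \<noteq> 0" "(A *v x + a) \<bullet> v = 0"
  shows "v \<bullet> (A *v v) \<noteq> 0"
proof
  assume iso: "v \<bullet> (A *v v) = 0"
  have Bs: "symmetric_matrix B" and Bv: "v \<bullet> (B *v v) < 0"
    using B v by (auto simp: negative_definite_def)
  obtain e where x: "quadratic_fun A a c x = 0" and e: "e > 0"
    and min: "\<And>y. quadratic_fun A a c y = 0 \<Longrightarrow> dist x y < e \<Longrightarrow>
      quadratic_fun B b k x \<le> quadratic_fun B b k y"
    using loc by (auto simp: local_minimizer_on_def gtre_feasible_def)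
  have ge: "0 \<le> 2 * t * ((B *v x + b) \<bullet> v) + t\<^sup>2 * (v \<bullet> (B *v v))" if "\<bar>t\<bar> * norm v < e" for t
  proof -
    have "quadratic_fun A a c (x + t *\<^sub>R v) = 0"
      using x iso v(2) by (simp add: quadratic_fun_add[OF A] quadratic_form_scaleR del: inner_scaleR_left)
    moreover have "dist x (x + t *\<^sub>R v) < e" using that by (simp add: dist_norm)
    ultimately have "quadratic_fun B b k x \<le> quadratic_fun B b k (x + t *\<^sub>R v)" by (rule min)
    then show ?thesis by (simp add: quadratic_fun_add[OF Bs] quadratic_form_scaleR mult.assoc del: inner_scaleR_left)
  qed
  define t where "t = e / (2 * norm v)"
  have t: "t > 0" "\<bar>t\<bar> * norm v < e" "\<bar>-t\<bar> * norm v < e" using e v by (auto simp: t_def)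
  have "0 \<le> t\<^sup>2 * (v \<bullet> (B *v v))" using ge[OF t(2)] ge[OF t(3)] by simp
  then show False using Bv t(1) by (simp add: zero_le_mult_iff)
qed

text \<open>The multiplier rule needs a regular point.  A singular local minimizer is the only feasible
  point: by the exact expansion at \<open>x\<close>, the difference to another one would be an isotropic vector.\<close>

lemma local_nonglobal_gradient_nonzero:
  assumes A: "symmetric_matrix A" and B: "negative_definite B"
    and x: "local_nonglobal_minimizer_on (quadratic_fun B b k) (gtre_feasible A a c) x"
  shows "A *v x + a \<noteq> 0"
proof
  assume g: "A *v x + a = 0"
  have loc: "local_minimizer_on (quadratic_fun B b k) (gtre_feasible A a c) x"
    and ng: "\<not> global_minimizer_on (quadratic_fun B b k) (gtre_feasible A a c) x"
    using x by (auto simp: local_nonglobal_minimizer_on_def)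
  have fx: "quadratic_fun A a c x = 0" using loc by (auto simp: local_minimizer_on_def gtre_feasible_def)
  have only: "y = x" if "y \<in> gtre_feasible A a c" for y
  proof (rule ccontr)
    assume "y \<noteq> x"
    then have "(y - x) \<bullet> (A *v (y - x)) \<noteq> 0"
      using tangent_not_isotropic[OF A B loc, of "y - x"] g by simp
    moreover have "quadratic_fun A a c (x + (y - x)) = 0" using that by (simp add: gtre_feasible_def)
    ultimately show False using fx g by (simp only: quadratic_fun_add[OF A]) simp
  qed
  have "x \<in> gtre_feasible A a c" using fx by (simp add: gtre_feasible_def)
  then have "global_minimizer_on (quadratic_fun B b k) (gtre_feasible A a c) x"
    unfolding global_minimizer_on_def using only by (metis order_refl)
  then show False using ng by contradiction
qed

text \<open>The curve that yields both optimality conditions.  The number \<open>\<epsilon> * \<rho> \<epsilon>\<close> is the nonzero root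
  of the constraint restricted to the line through \<open>x\<close> in the direction \<open>v + \<epsilon> g\<close>; the factor \<open>\<epsilon>\<close> is
  split off so that the curve passes through \<open>x\<close> with nonzero speed.\<close>

lemma feasible_curve:
  fixes x v :: "real ^ 'n"
  assumes A: "symmetric_matrix A" and B: "negative_definite B"
    and loc: "local_minimizer_on (quadratic_fun B b k) (gtre_feasible A a c) x"
    and v: "v \<noteq> 0" "(A *v x + a) \<bullet> v = 0" and g: "A *v x + a \<noteq> 0"
  obtains \<rho> r where "(\<rho> \<longlongrightarrow> r) (at (0::real))" and "r \<noteq> 0"
    and "\<forall>\<^sub>F \<epsilon> in at 0. \<rho> \<epsilon> \<noteq> 0 \<and>
      quadratic_fun A a c (x + (\<epsilon> * \<rho> \<epsilon>) *\<^sub>R (v + \<epsilon> *\<^sub>R (A *v x + a))) = 0 \<and>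
      quadratic_fun B b k x \<le> quadratic_fun B b k (x + (\<epsilon> * \<rho> \<epsilon>) *\<^sub>R (v + \<epsilon> *\<^sub>R (A *v x + a)))"
proof -
  define g where "g = A *v x + a"
  define w where "w = (\<lambda>\<epsilon>::real. v + \<epsilon> *\<^sub>R g)"
  define q where "q = (\<lambda>\<epsilon>. w \<epsilon> \<bullet> (A *v w \<epsilon>))"
  define \<rho> where "\<rho> = (\<lambda>\<epsilon>. - 2 * (g \<bullet> g) / q \<epsilon>)"
  obtain e where fx: "quadratic_fun A a c x = 0" and e: "e > 0"
    and min: "\<And>y. quadratic_fun A a c y = 0 \<Longrightarrow> dist x y < e \<Longrightarrow>
      quadratic_fun B b k x \<le> quadratic_fun B b k y"
    using loc by (auto simp: local_minimizer_on_def gtre_feasible_def)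
  have g0: "g \<bullet> g \<noteq> 0" using g by (simp add: g_def)
  have vAv: "v \<bullet> (A *v v) \<noteq> 0" by (rule tangent_not_isotropic[OF A B loc v])
  have w: "(w \<longlongrightarrow> v) (at 0)" unfolding w_def by (rule tendsto_eq_intros refl | simp)+
  have q: "(q \<longlongrightarrow> v \<bullet> (A *v v)) (at 0)" unfolding q_def
    by (intro tendsto_inner w bounded_linear.tendsto[OF matrix_vector_mul_bounded_linear])
  have \<rho>: "(\<rho> \<longlongrightarrow> - 2 * (g \<bullet> g) / (v \<bullet> (A *v v))) (at 0)" unfolding \<rho>_def
    by (intro tendsto_divide q vAv tendsto_const)
  have "((\<lambda>\<epsilon>. (\<epsilon> * \<rho> \<epsilon>) *\<^sub>R w \<epsilon>) \<longlongrightarrow> (0 * (- 2 * (g \<bullet> g) / (v \<bullet> (A *v v)))) *\<^sub>R v) (at 0)"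
    by (intro tendsto_scaleR tendsto_mult \<rho> w tendsto_ident_at)
  then have small: "\<forall>\<^sub>F \<epsilon> in at 0. dist ((\<epsilon> * \<rho> \<epsilon>) *\<^sub>R w \<epsilon>) 0 < e"
    using e by (simp add: tendsto_iff)
  have q0: "\<forall>\<^sub>F \<epsilon> in at 0. q \<epsilon> \<noteq> 0" by (rule tendsto_imp_eventually_ne[OF q vAv])
  have "\<forall>\<^sub>F \<epsilon> in at 0. \<rho> \<epsilon> \<noteq> 0 \<and> quadratic_fun A a c (x + (\<epsilon> * \<rho> \<epsilon>) *\<^sub>R w \<epsilon>) = 0 \<and>
      quadratic_fun B b k x \<le> quadratic_fun B b k (x + (\<epsilon> * \<rho> \<epsilon>) *\<^sub>R w \<epsilon>)"
    using small q0
  proof eventually_elim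
    case (elim \<epsilon>)
    have gw: "g \<bullet> w \<epsilon> = \<epsilon> * (g \<bullet> g)" using v(2) by (simp add: w_def g_def inner_add_right)
    have \<rho>q: "\<rho> \<epsilon> * q \<epsilon> = - 2 * (g \<bullet> g)" using elim(2) by (simp add: \<rho>_def)
    have "quadratic_fun A a c (x + (\<epsilon> * \<rho> \<epsilon>) *\<^sub>R w \<epsilon>)
        = 2 * (\<epsilon> * \<rho> \<epsilon> * (\<epsilon> * (g \<bullet> g))) + (\<epsilon> * \<rho> \<epsilon>)\<^sup>2 * q \<epsilon>"
      by (simp add: quadratic_fun_add[OF A] quadratic_form_scaleR fx gw[unfolded g_def] g_def q_def
          del: inner_scaleR_left)
    also have "\<dots> = \<epsilon>\<^sup>2 * \<rho> \<epsilon> * (2 * (g \<bullet> g) + \<rho> \<epsilon> * q \<epsilon>)"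
      by (simp add: power2_eq_square algebra_simps)
    finally have feas: "quadratic_fun A a c (x + (\<epsilon> * \<rho> \<epsilon>) *\<^sub>R w \<epsilon>) = 0" using \<rho>q by simp
    have "dist x (x + (\<epsilon> * \<rho> \<epsilon>) *\<^sub>R w \<epsilon>) < e" using elim(1) by (simp add: dist_norm)
    then show ?case using feas min g0 elim(2) by (simp add: \<rho>_def)
  qed
  moreover have "- 2 * (g \<bullet> g) / (v \<bullet> (A *v v)) \<noteq> 0" using g0 vAv by simp
  ultimately show thesis using that[OF \<rho>] by (simp add: w_def g_def)
qed

text \<open>The change of the objective along the curve is \<open>\<epsilon>\<close> times a function with limit
  \<open>r * (2 * (p \<bullet> v))\<close>, where \<open>r \<noteq> 0\<close>.  It is nonnegative for both signs of \<open>\<epsilon>\<close>, so this limit vanishes.\<close>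

lemma first_order_condition:
  assumes A: "symmetric_matrix A" and B: "negative_definite B"
    and loc: "local_minimizer_on (quadratic_fun B b k) (gtre_feasible A a c) x"
    and g: "A *v x + a \<noteq> 0" and v: "(A *v x + a) \<bullet> v = 0"
  shows "(B *v x + b) \<bullet> v = 0"
proof (cases "v = 0")
  case False
  have Bs: "symmetric_matrix B" using B by (simp add: negative_definite_def)
  define w where "w = (\<lambda>\<epsilon>::real. v + \<epsilon> *\<^sub>R (A *v x + a))"
  obtain \<rho> r where \<rho>: "(\<rho> \<longlongrightarrow> r) (at (0::real))" and r: "r \<noteq> 0"
    and ev: "\<forall>\<^sub>F \<epsilon> in at 0. \<rho> \<epsilon> \<noteq> 0 \<and> quadratic_fun A a c (x + (\<epsilon> * \<rho> \<epsilon>) *\<^sub>R w \<epsilon>) = 0 \<and>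
      quadratic_fun B b k x \<le> quadratic_fun B b k (x + (\<epsilon> * \<rho> \<epsilon>) *\<^sub>R w \<epsilon>)"
    using feasible_curve[OF A B loc False v g] unfolding w_def by blast
  define s where "s = (\<lambda>\<epsilon>. \<rho> \<epsilon> * (2 * ((B *v x + b) \<bullet> w \<epsilon>) + (\<epsilon> * \<rho> \<epsilon>) * (w \<epsilon> \<bullet> (B *v w \<epsilon>))))"
  have w: "(w \<longlongrightarrow> v) (at 0)" unfolding w_def by (rule tendsto_eq_intros refl | simp)+
  have "(s \<longlongrightarrow> r * (2 * ((B *v x + b) \<bullet> v) + (0 * r) * (v \<bullet> (B *v v)))) (at 0)" unfolding s_def
    by (intro tendsto_inner tendsto_mult tendsto_add w \<rho> tendsto_const tendsto_ident_at
        bounded_linear.tendsto[OF matrix_vector_mul_bounded_linear])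
  then have s: "(s \<longlongrightarrow> r * (2 * ((B *v x + b) \<bullet> v))) (at 0)" by simp
  have sgn: "\<forall>\<^sub>F \<epsilon> in at 0. 0 \<le> \<epsilon> * s \<epsilon>"
    using ev
  proof eventually_elim
    case (elim \<epsilon>)
    then have "0 \<le> 2 * ((\<epsilon> * \<rho> \<epsilon>) * ((B *v x + b) \<bullet> w \<epsilon>)) + (\<epsilon> * \<rho> \<epsilon>)\<^sup>2 * (w \<epsilon> \<bullet> (B *v w \<epsilon>))"
      by (simp add: quadratic_fun_add[OF Bs] quadratic_form_scaleR del: inner_scaleR_left)
    also have "\<dots> = \<epsilon> * s \<epsilon>" by (simp add: s_def power2_eq_square algebra_simps)
    finally show ?case .
  qed
  have R: "\<forall>\<^sub>F \<epsilon> in at_right 0. 0 \<le> \<epsilon> * s \<epsilon>" and L: "\<forall>\<^sub>F \<epsilon> in at_left 0. 0 \<le> \<epsilon> * s \<epsilon>"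
    using sgn unfolding eventually_at_split by blast+
  have "0 \<le> r * (2 * ((B *v x + b) \<bullet> v))"
  proof (rule tendsto_lowerbound[OF tendsto_within_subset[OF s]])
    show "\<forall>\<^sub>F \<epsilon> in at_right 0. 0 \<le> s \<epsilon>"
      using R eventually_at_right_less[of 0] by eventually_elim (simp add: zero_le_mult_iff)
  qed auto
  moreover have "r * (2 * ((B *v x + b) \<bullet> v)) \<le> 0"
  proof (rule tendsto_upperbound[OF tendsto_within_subset[OF s]])
    have "\<forall>\<^sub>F \<epsilon> in at_left 0. \<epsilon> < (0::real)" by (simp add: eventually_at_filter)
    with L show "\<forall>\<^sub>F \<epsilon> in at_left 0. s \<epsilon> \<le> 0" by eventually_elim (simp add: zero_le_mult_iff)
  qed auto
  ultimately show ?thesis using r by simp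
qed simp

text \<open>The local consequences of being a local-nonglobal minimizer, from which uniqueness follows by
  algebra.  The first two parts are the first- and second-order necessary conditions; the last one
  records that \<open>x\<close> is not global, and makes \<open>x\<close> a saddle point of the Lagrangian.\<close>

definition saddle_multiplier ::
  "real ^ 'n ^ 'n \<Rightarrow> real ^ 'n \<Rightarrow> real ^ 'n ^ 'n \<Rightarrow> real ^ 'n \<Rightarrow> real ^ 'n \<Rightarrow> real \<Rightarrow> bool" where
  "saddle_multiplier B b A a x \<alpha> \<longleftrightarrow>
     (B *v x + b) + \<alpha> *\<^sub>R (A *v x + a) = 0 \<and>
     (\<forall>v. (A *v x + a) \<bullet> v = 0 \<longrightarrow> 0 \<le> v \<bullet> ((B + \<alpha> *\<^sub>R A) *v v)) \<and>
     (\<exists>u. u \<bullet> ((B + \<alpha> *\<^sub>R A) *v u) < 0)"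

text \<open>At a stationary point the second-order expansion of the Lagrangian is exact, and at feasible
  points the Lagrangian is the objective.\<close>

lemma objective_difference:
  assumes A: "symmetric_matrix A" and B: "symmetric_matrix B"
    and stat: "(B *v x + b) + \<alpha> *\<^sub>R (A *v x + a) = 0"
    and "quadratic_fun A a c x = 0" "quadratic_fun A a c (x + h) = 0"
  shows "quadratic_fun B b k (x + h) - quadratic_fun B b k x = h \<bullet> ((B + \<alpha> *\<^sub>R A) *v h)"
proof -
  have "(B *v x + b) \<bullet> h + \<alpha> * ((A *v x + a) \<bullet> h) = 0"
    using arg_cong[OF stat, of "\<lambda>z. z \<bullet> h"] by (simp add: inner_add_left)
  moreover have "2 * ((A *v x + a) \<bullet> h) + h \<bullet> (A *v h) = 0"
    using assms(4,5) by (simp add: quadratic_fun_add[OF A])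
  then have "2 * (\<alpha> * ((A *v x + a) \<bullet> h)) + \<alpha> * (h \<bullet> (A *v h)) = 0"
    by (metis distrib_left mult.left_commute mult_zero_right)
  ultimately show ?thesis
    by (simp add: quadratic_fun_add[OF B] quadratic_form_linear_combination)
qed

lemma second_order_condition:
  assumes A: "symmetric_matrix A" and B: "negative_definite B"
    and loc: "local_minimizer_on (quadratic_fun B b k) (gtre_feasible A a c) x"
    and g: "A *v x + a \<noteq> 0" and v: "(A *v x + a) \<bullet> v = 0"
    and stat: "(B *v x + b) + \<alpha> *\<^sub>R (A *v x + a) = 0"
  shows "0 \<le> v \<bullet> ((B + \<alpha> *\<^sub>R A) *v v)"
proof (cases "v = 0")
  case False
  have Bs: "symmetric_matrix B" using B by (simp add: negative_definite_def)
  have fx: "quadratic_fun A a c x = 0" using loc by (auto simp: local_minimizer_on_def gtre_feasible_def)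
  define w where "w = (\<lambda>\<epsilon>::real. v + \<epsilon> *\<^sub>R (A *v x + a))"
  obtain \<rho> where
    ev: "\<forall>\<^sub>F \<epsilon> in at 0. \<rho> \<epsilon> \<noteq> 0 \<and> quadratic_fun A a c (x + (\<epsilon> * \<rho> \<epsilon>) *\<^sub>R w \<epsilon>) = 0 \<and>
      quadratic_fun B b k x \<le> quadratic_fun B b k (x + (\<epsilon> * \<rho> \<epsilon>) *\<^sub>R w \<epsilon>)"
    using feasible_curve[OF A B loc False v g] unfolding w_def by blast
  have w: "(w \<longlongrightarrow> v) (at 0)" unfolding w_def by (rule tendsto_eq_intros refl | simp)+
  have lim: "((\<lambda>\<epsilon>. w \<epsilon> \<bullet> ((B + \<alpha> *\<^sub>R A) *v w \<epsilon>)) \<longlongrightarrow> v \<bullet> ((B + \<alpha> *\<^sub>R A) *v v)) (at 0)"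
    by (intro tendsto_inner w bounded_linear.tendsto[OF matrix_vector_mul_bounded_linear])
  have ne: "\<forall>\<^sub>F \<epsilon> in at 0. \<epsilon> \<noteq> (0::real)" by (simp add: eventually_at_filter)
  show ?thesis
  proof (rule tendsto_lowerbound[OF lim])
    show "\<forall>\<^sub>F \<epsilon> in at 0. 0 \<le> w \<epsilon> \<bullet> ((B + \<alpha> *\<^sub>R A) *v w \<epsilon>)"
      using ev ne
    proof eventually_elim
      case (elim \<epsilon>)
      then have "0 \<le> ((\<epsilon> * \<rho> \<epsilon>) *\<^sub>R w \<epsilon>) \<bullet> ((B + \<alpha> *\<^sub>R A) *v ((\<epsilon> * \<rho> \<epsilon>) *\<^sub>R w \<epsilon>))"
        using objective_difference[OF A Bs stat fx, of "(\<epsilon> * \<rho> \<epsilon>) *\<^sub>R w \<epsilon>" k] by linarith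
      then have "0 \<le> (\<epsilon> * \<rho> \<epsilon>)\<^sup>2 * (w \<epsilon> \<bullet> ((B + \<alpha> *\<^sub>R A) *v w \<epsilon>))"
        by (simp only: quadratic_form_scaleR)
      moreover have "(\<epsilon> * \<rho> \<epsilon>)\<^sup>2 > 0" using elim by simp
      ultimately show ?case by (simp only: zero_le_mult_iff) auto
    qed
  qed simp
qed simp

lemma local_nonglobal_saddle_multiplier:
  assumes A: "symmetric_matrix A" and B: "negative_definite B"
    and x: "local_nonglobal_minimizer_on (quadratic_fun B b k) (gtre_feasible A a c) x"
  obtains \<alpha> where "saddle_multiplier B b A a x \<alpha>"
proof -
  have Bs: "symmetric_matrix B" using B by (simp add: negative_definite_def)
  have loc: "local_minimizer_on (quadratic_fun B b k) (gtre_feasible A a c) x"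
    and ng: "\<not> global_minimizer_on (quadratic_fun B b k) (gtre_feasible A a c) x"
    using x by (auto simp: local_nonglobal_minimizer_on_def)
  have fx: "quadratic_fun A a c x = 0" using loc by (auto simp: local_minimizer_on_def gtre_feasible_def)
  define g where "g = A *v x + a"
  define p where "p = B *v x + b"
  have g: "g \<noteq> 0" unfolding g_def by (rule local_nonglobal_gradient_nonzero[OF A B x])
  \<comment> \<open>With this \<open>\<alpha>\<close> the vector \<open>p + \<alpha> g\<close> is the component of \<open>p\<close> tangent to the quadric.\<close>
  define \<alpha> where "\<alpha> = - (p \<bullet> g) / (g \<bullet> g)"
  have orth: "g \<bullet> (p + \<alpha> *\<^sub>R g) = 0" using g by (simp add: \<alpha>_def inner_add_right inner_diff_right inner_commute)
  then have "p \<bullet> (p + \<alpha> *\<^sub>R g) = 0"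
    using first_order_condition[OF A B loc, of "p + \<alpha> *\<^sub>R g"] g by (simp add: g_def p_def)
  with orth have "(p + \<alpha> *\<^sub>R g) \<bullet> (p + \<alpha> *\<^sub>R g) = 0" by (simp add: inner_add_left)
  then have stat: "(B *v x + b) + \<alpha> *\<^sub>R (A *v x + a) = 0" by (simp add: g_def p_def)
  obtain y where y: "quadratic_fun A a c y = 0" "quadratic_fun B b k y < quadratic_fun B b k x"
    using ng fx by (auto simp: global_minimizer_on_def gtre_feasible_def not_le)
  have "(y - x) \<bullet> ((B + \<alpha> *\<^sub>R A) *v (y - x)) < 0"
    using objective_difference[OF A Bs stat fx, of "y - x" k] y by simp
  moreover have "0 \<le> v \<bullet> ((B + \<alpha> *\<^sub>R A) *v v)" if "(A *v x + a) \<bullet> v = 0" for v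
    using second_order_condition[OF A B loc _ that stat] g by (simp add: g_def)
  ultimately have "saddle_multiplier B b A a x \<alpha>" using stat by (auto simp: saddle_multiplier_def)
  then show thesis by (rule that)
qed

section \<open>Two saddle multipliers\<close>

text \<open>Conjugate decomposition: a vector \<open>d\<close> with \<open>M d\<close> proportional to \<open>g\<close> is \<open>M\<close>-orthogonal to the
  hyperplane \<open>g \<bullet> v = 0\<close>.  If \<open>d\<close> is transversal to it, then \<open>d\<close> and the hyperplane together
  determine the form.\<close>

lemma conjugate_decomposition:
  fixes d g u :: "real ^ 'n"
  assumes M: "symmetric_matrix M" and d: "M *v d = \<kappa> *\<^sub>R g" and gd: "g \<bullet> d \<noteq> 0"
  obtains t v where "u = t *\<^sub>R d + v" "g \<bullet> v = 0"
    "u \<bullet> (M *v u) = t\<^sup>2 * (d \<bullet> (M *v d)) + v \<bullet> (M *v v)"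
proof -
  define t where "t = (g \<bullet> u) / (g \<bullet> d)"
  define v where "v = u - t *\<^sub>R d"
  have gv: "g \<bullet> v = 0" using gd by (simp add: v_def t_def inner_diff_right)
  have vd: "v \<bullet> (M *v d) = 0" using gv by (simp add: d inner_commute)
  then have dv: "d \<bullet> (M *v v) = 0" using symmetric_matrix_inner_commute[OF M] by metis
  have u: "u = t *\<^sub>R d + v" by (simp add: v_def)
  show thesis
  proof (rule that[OF u gv])
    show "u \<bullet> (M *v u) = t\<^sup>2 * (d \<bullet> (M *v d)) + v \<bullet> (M *v v)"
      unfolding u using vd dv
      by (simp add: matrix_vector_right_distrib matrix_vector_mult_scaleR inner_add_left
          inner_add_right power2_eq_square)
  qed
qed

text \<open>The sign hypothesis says that \<open>y\<close> has the smaller objective value.\<close>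

lemma saddle_multiplier_ordered_contradiction:
  fixes x y :: "real ^ 'n"
  assumes A: "symmetric_matrix A" and B: "negative_definite B"
    and x: "saddle_multiplier B b A a x \<alpha>" and y: "saddle_multiplier B b A a y \<beta>"
    and gap: "(y - x) \<bullet> ((B + \<alpha> *\<^sub>R A) *v (y - x)) < 0"
      "(y - x) \<bullet> ((B + \<beta> *\<^sub>R A) *v (y - x)) = - ((y - x) \<bullet> ((B + \<alpha> *\<^sub>R A) *v (y - x)))"
    and Ml: "(B + \<alpha> *\<^sub>R A) *v (y - x) = (\<alpha> - \<beta>) *\<^sub>R (A *v y + a)"
    and Mm: "(B + \<beta> *\<^sub>R A) *v (y - x) = (\<alpha> - \<beta>) *\<^sub>R (A *v x + a)"
  shows False
proof -
  define d where "d = y - x"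
  define Q where "Q = (\<lambda>v. v \<bullet> (A *v v))"
  define R where "R = (\<lambda>v. v \<bullet> (B *v v))"
  have M: "v \<bullet> ((B + \<nu> *\<^sub>R A) *v v) = R v + \<nu> * Q v" for \<nu> v
    by (simp add: R_def Q_def quadratic_form_linear_combination)
  have R: "R v < 0" if "v \<noteq> 0" for v
    using B that by (auto simp: negative_definite_def R_def)
  have Bs: "symmetric_matrix B" using B by (simp add: negative_definite_def)
  note sym = symmetric_matrix_linear_combination[OF A Bs]
  have d: "R d + \<alpha> * Q d < 0" "R d + \<beta> * Q d = - (R d + \<alpha> * Q d)"
    using gap by (simp_all add: d_def M)
  have tx: "0 \<le> R v + \<alpha> * Q v" if "(A *v x + a) \<bullet> v = 0" for v
    using x that by (auto simp: saddle_multiplier_def M)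
  have ty: "0 \<le> R v + \<beta> * Q v" if "(A *v y + a) \<bullet> v = 0" for v
    using y that by (auto simp: saddle_multiplier_def M)
  obtain u where u: "R u + \<beta> * Q u < 0" using y by (auto simp: saddle_multiplier_def M)
  have Rd: "R d < 0" using d by (intro R) (auto simp: R_def Q_def)
  have gx: "(A *v x + a) \<bullet> d \<noteq> 0"
    using gap Mm by (auto simp: d_def inner_commute)
  have gy: "(A *v y + a) \<bullet> d \<noteq> 0"
    using gap Ml by (auto simp: d_def inner_commute)
  \<comment> \<open>Adding and subtracting the two conditions on \<open>d\<close> isolates \<open>Q d\<close> with the factors \<open>\<alpha> \<plusminus> \<beta>\<close>.\<close>
  have abs: "\<bar>\<alpha>\<bar> < \<bar>\<beta>\<bar>"
  proof -
    have "(\<alpha> + \<beta>) * Q d > 0" "(\<alpha> - \<beta>) * Q d < 0" using d Rd by (simp_all add: algebra_simps)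
    then have "((\<alpha> + \<beta>) * Q d) * ((\<alpha> - \<beta>) * Q d) < 0" by (rule mult_pos_neg)
    then have "(\<alpha>\<^sup>2 - \<beta>\<^sup>2) * (Q d)\<^sup>2 < 0" by (simp add: power2_eq_square algebra_simps)
    then have "\<alpha>\<^sup>2 < \<beta>\<^sup>2" by (simp add: mult_less_0_iff)
    then show ?thesis by (metis abs_le_square_iff not_le)
  qed
  \<comment> \<open>\<open>M\<^sub>\<beta>\<close> is positive at \<open>d\<close>, so the negative direction \<open>u\<close> may be moved into the tangent space at \<open>x\<close>.\<close>
  obtain v where v: "(A *v x + a) \<bullet> v = 0" "R v + \<beta> * Q v < 0"
  proof -
    obtain t v where tv: "(A *v x + a) \<bullet> v = 0"
      "R u + \<beta> * Q u = t\<^sup>2 * (R d + \<beta> * Q d) + (R v + \<beta> * Q v)"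
      using conjugate_decomposition[OF sym Mm[folded d_def] gx, of u] unfolding M by metis
    have "0 \<le> t\<^sup>2 * (R d + \<beta> * Q d)" using d by simp
    with tv u have "R v + \<beta> * Q v < 0" by linarith
    with tv(1) show thesis by (rule that)
  qed
  have v0: "v \<noteq> 0" using v(2) by (auto simp: R_def Q_def)
  have pos: "0 < \<alpha> * Q v" using tx[OF v(1)] R[OF v0] by linarith
  have opp: "\<alpha> * \<beta> < 0"
  proof -
    have lt: "\<beta> * Q v < \<alpha> * Q v" using tx[OF v(1)] v(2) by linarith
    show ?thesis
    proof (cases "Q v > 0")
      case True
      then have "\<alpha> > 0" "\<beta> < \<alpha>" using pos lt by (simp_all add: zero_less_mult_iff)
      then show ?thesis using abs by (simp add: mult_less_0_iff)
    next
      case False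
      then have "\<alpha> < 0" "\<alpha> < \<beta>" using pos lt by (auto simp: zero_less_mult_iff mult_less_cancel_right)
      then show ?thesis using abs by (simp add: mult_less_0_iff)
    qed
  qed
  \<comment> \<open>Opposite signs make \<open>M\<^sub>\<alpha>\<close> negative definite: on the tangent space at \<open>y\<close> and at \<open>d\<close> separately.\<close>
  have neg: "R w + \<alpha> * Q w < 0" if "(A *v y + a) \<bullet> w = 0" "w \<noteq> 0" for w
  proof -
    have "0 < \<beta> * Q w" using ty[OF that(1)] R[OF that(2)] by linarith
    then have "\<alpha> * Q w < 0" using opp by (auto simp: zero_less_mult_iff mult_less_0_iff)
    then show ?thesis using R[OF that(2)] by linarith
  qed
  obtain t w where tw: "v = t *\<^sub>R d + w" "(A *v y + a) \<bullet> w = 0"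
    "R v + \<alpha> * Q v = t\<^sup>2 * (R d + \<alpha> * Q d) + (R w + \<alpha> * Q w)"
    using conjugate_decomposition[OF sym Ml[folded d_def] gy, of v] unfolding M by metis
  have "R v + \<alpha> * Q v < 0"
  proof (cases "w = 0")
    case True
    then have "t \<noteq> 0" using tw(1) v0 by auto
    then show ?thesis using tw(3) d(1) True by (simp add: R_def Q_def mult_pos_neg)
  next
    case False
    have "t\<^sup>2 * (R d + \<alpha> * Q d) \<le> 0" using d(1) by (simp add: mult_nonneg_nonpos)
    then show ?thesis using tw(3) neg[OF tw(2) False] by linarith
  qed
  then show False using tx[OF v(1)] by linarith
qed

lemma saddle_multiplier_unique_point:
  fixes x y :: "real ^ 'n"
  assumes A: "symmetric_matrix A" and B: "negative_definite B"
    and x: "saddle_multiplier B b A a x \<alpha>" and y: "saddle_multiplier B b A a y \<beta>"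
    and fx: "quadratic_fun A a c x = 0" and fy: "quadratic_fun A a c y = 0"
  shows "x = y"
proof (rule ccontr)
  assume "x \<noteq> y"
  define d where "d = y - x"
  define gap where "gap = quadratic_fun B b 0 y - quadratic_fun B b 0 x"
  have Bs: "symmetric_matrix B" and dBd: "d \<bullet> (B *v d) < 0"
    using B \<open>x \<noteq> y\<close> by (auto simp: negative_definite_def d_def)
  note sym = symmetric_matrix_linear_combination[OF A Bs]
  have sx: "(B *v x + b) + \<alpha> *\<^sub>R (A *v x + a) = 0" and sy: "(B *v y + b) + \<beta> *\<^sub>R (A *v y + a) = 0"
    using x y by (auto simp: saddle_multiplier_def)
  have M: "(B + \<nu> *\<^sub>R A) *v d =
      ((B *v y + b) + \<nu> *\<^sub>R (A *v y + a)) - ((B *v x + b) + \<nu> *\<^sub>R (A *v x + a))" for \<nu>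
    by (simp add: d_def matrix_vector_mult_add_rdistrib scaleR_matrix_vector_assoc[symmetric]
        matrix_vector_mult_diff_distrib algebra_simps)
  have Ml: "(B + \<alpha> *\<^sub>R A) *v d = (\<alpha> - \<beta>) *\<^sub>R (A *v y + a)"
    unfolding M sx using sy by (simp add: scaleR_diff_left eq_neg_iff_add_eq_0[symmetric])
  have Mm: "(B + \<beta> *\<^sub>R A) *v d = (\<alpha> - \<beta>) *\<^sub>R (A *v x + a)"
    unfolding M sy using sx by (simp add: scaleR_diff_left eq_neg_iff_add_eq_0[symmetric])
  have gl: "d \<bullet> ((B + \<alpha> *\<^sub>R A) *v d) = gap"
    using objective_difference[OF A Bs sx fx, of d 0] fy by (simp add: d_def gap_def)
  have gm: "d \<bullet> ((B + \<beta> *\<^sub>R A) *v d) = - gap"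
    using objective_difference[OF A Bs sy fy, of "-d" 0] fx
    by (simp add: d_def gap_def) (simp add: vec.neg algebra_simps)
  consider "gap < 0" | "gap > 0" | "gap = 0" by linarith
  then show False
  proof cases
    case 1
    show False
      by (rule saddle_multiplier_ordered_contradiction[OF A B x y])
        (use 1 gl gm Ml Mm in \<open>simp_all add: d_def\<close>)
  next
    case 2
    have neg: "x - y = - d" by (simp add: d_def)
    have mneg: "M *v (- d) = - (M *v d)" for M :: "real^'n^'n" by (simp add: vec.neg)
    show False
      by (rule saddle_multiplier_ordered_contradiction[OF A B y x])
        (use 2 gl gm Ml Mm in \<open>simp_all add: neg mneg scaleR_diff_left inner_diff_right\<close>)
  next
    \<comment> \<open>Equal objective values force equal multipliers, and then \<open>d\<close> is a null vector of \<open>M\<^sub>\<alpha>\<close>.\<close>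
    case 3
    have "d \<bullet> (B *v d) + \<alpha> * (d \<bullet> (A *v d)) = 0" "d \<bullet> (B *v d) + \<beta> * (d \<bullet> (A *v d)) = 0"
      using gl gm 3 by (simp_all add: quadratic_form_linear_combination)
    then have eq: "\<alpha> = \<beta>" and Ad: "d \<bullet> (A *v d) \<noteq> 0"
      using dBd by (auto, metis add_left_cancel less_irrefl mult_cancel_right mult_zero_right add_0_right)
    have "quadratic_fun A a c (x + d) = 0" using fy by (simp add: d_def)
    then have gd: "(A *v x + a) \<bullet> d \<noteq> 0" using fx Ad by (auto simp: quadratic_fun_add[OF A])
    obtain u where u: "u \<bullet> ((B + \<alpha> *\<^sub>R A) *v u) < 0" using x by (auto simp: saddle_multiplier_def)
    have "(B + \<alpha> *\<^sub>R A) *v d = 0 *\<^sub>R (A *v x + a)" using Ml eq by simp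
    then obtain t v where v: "(A *v x + a) \<bullet> v = 0"
      "u \<bullet> ((B + \<alpha> *\<^sub>R A) *v u) =
        t\<^sup>2 * (d \<bullet> ((B + \<alpha> *\<^sub>R A) *v d)) + v \<bullet> ((B + \<alpha> *\<^sub>R A) *v v)"
      using conjugate_decomposition[OF sym _ gd, of \<alpha> 0 u] by metis
    then have "v \<bullet> ((B + \<alpha> *\<^sub>R A) *v v) < 0" using u gl 3 by simp
    moreover have "0 \<le> v \<bullet> ((B + \<alpha> *\<^sub>R A) *v v)" using x v(1) by (simp add: saddle_multiplier_def)
    ultimately show False by linarith
  qed
qed

theorem theorem3p23:
  fixes A\<^sub>0 A\<^sub>1 :: "real ^ 'n ^ 'n" and b\<^sub>0 b\<^sub>1 :: "real ^ 'n" and c\<^sub>1 :: real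
  assumes "symmetric_matrix A\<^sub>0" and "symmetric_matrix A\<^sub>1"
    and "jointly_negative_definite A\<^sub>0 A\<^sub>1"
  shows "\<exists>\<^sub>\<le>\<^sub>1 x. local_nonglobal_minimizer_on (gtre_objective A\<^sub>0 b\<^sub>0) (gtre_feasible A\<^sub>1 b\<^sub>1 c\<^sub>1) x"
proof (rule Uniq_I)
  fix x y
  assume x: "local_nonglobal_minimizer_on (gtre_objective A\<^sub>0 b\<^sub>0) (gtre_feasible A\<^sub>1 b\<^sub>1 c\<^sub>1) x"
    and y: "local_nonglobal_minimizer_on (gtre_objective A\<^sub>0 b\<^sub>0) (gtre_feasible A\<^sub>1 b\<^sub>1 c\<^sub>1) y"
  obtain \<nu> where B: "negative_definite (A\<^sub>0 + \<nu> *\<^sub>R A\<^sub>1)"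
    using assms(3) by (auto simp: jointly_negative_definite_def)
  have eq: "gtre_objective A\<^sub>0 b\<^sub>0 z =
      quadratic_fun (A\<^sub>0 + \<nu> *\<^sub>R A\<^sub>1) (b\<^sub>0 + \<nu> *\<^sub>R b\<^sub>1) (0 + \<nu> * c\<^sub>1) z"
    if "z \<in> gtre_feasible A\<^sub>1 b\<^sub>1 c\<^sub>1" for z
    using that unfolding quadratic_fun_linear_combination
    by (simp add: gtre_objective_def gtre_feasible_def)
  note shifted = local_nonglobal_minimizer_on_cong[OF eq, THEN iffD1]
  obtain \<alpha> \<beta> where
    "saddle_multiplier (A\<^sub>0 + \<nu> *\<^sub>R A\<^sub>1) (b\<^sub>0 + \<nu> *\<^sub>R b\<^sub>1) A\<^sub>1 b\<^sub>1 x \<alpha>"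
    "saddle_multiplier (A\<^sub>0 + \<nu> *\<^sub>R A\<^sub>1) (b\<^sub>0 + \<nu> *\<^sub>R b\<^sub>1) A\<^sub>1 b\<^sub>1 y \<beta>"
    using local_nonglobal_saddle_multiplier[OF assms(2) B] shifted[OF _ x] shifted[OF _ y] by metis
  moreover have "quadratic_fun A\<^sub>1 b\<^sub>1 c\<^sub>1 x = 0" "quadratic_fun A\<^sub>1 b\<^sub>1 c\<^sub>1 y = 0"
    using x y by (auto simp: local_nonglobal_minimizer_on_def local_minimizer_on_def gtre_feasible_def)
  ultimately show "x = y" by (rule saddle_multiplier_unique_point[OF assms(2) B])
qed

end
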